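(* Let $C=\{z\in\mathbb{R}^n:Az-b\in K,\ l\le z\le u\}$ be nonempty, $M\in\mathbb{R}^{n\times n}$, $q\in\mathbb{R}^n$. Suppose $\bar z^0$ is an implicit extreme point of $C$ with associated index sets $(B,N_l,N_u,N_{fr},\mathcal{A},\bar{\mathcal{A}})$ (as described in the context), and let $N=N_l\cup N_u\cup N_{fr}$. Consider the system $$\begin{bmatrix} M_{BB} & M_{BN_{fr}} & -A^T_{\mathcal{A}B} & 0 & 0 & 0\\ M_{N_lB} & M_{N_lN_{fr}} & -A^T_{\mathcal{A}N_l} & -I_{N_l} & 0 & 0\\ M_{N_uB} & M_{N_uN_{fr}} & -A^T_{\mathcal{A}N_u} & 0 & I_{N_u} & 0\\ M_{N_{fr}B} & M_{N_{fr}N_{fr}} & -A^T_{\mathcal{A}N_{fr}} & 0 & 0 & 0\\ A_{\mathcal{A}B} & A_{\mathcal{A}N_{fr}} & 0 & 0 & 0 & 0\\ A_{\bar{\mathcal{A}}B} & A_{\bar{\mathcal{A}}N_{fr}} & 0 & 0 & 0 & -I_{\bar{\mathcal{A}}} \end{bmatrix} \begin{bmatrix} z_B \\ z_{N_{fr}} \\ \lambda_{\mathcal{A}} \\ w_{N_l} \\ v_{N_u} \\ s_{\bar{\mathcal{A}}}\end{bmatrix} =\begin{bmatrix} -q_B - M_{BN}\bar z^0_N\\ -q_{N_l} - M_{N_lN}\bar z^0_N\\ -q_{N_u} - M_{N_uN}\bar z^0_N\\ -q_{N_{fr}} - M_{N_{fr}N}\bar z^0_N\\ b_{\mathcal{A}}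 - A_{\mathcal{A}N}\bar z^0_N\\ b_{\bar{\mathcal{A}}} - A_{\bar{\mathcal{A}}N}\bar z^0_N \end{bmatrix}.$$ The matrix on the left-hand side is invertible if and only if $M$ is invertible on the lineality space of $C$. Moreover, for a solution of the system, the point $z=(z_B,z_{N_{fr}},\bar z^0_{N_l},\bar z^0_{N_u})$ satisfies $z\in\bar z^0+\operatorname{lin}C$ (so $z$ is an implicit extreme point of $C$) and $Mz+q\in\operatorname{aff}(N_C(z))$.
   Context: $A\in\mathbb{R}^{m\times n}$ has nonzero rows, $b\in\mathbb{R}^m$, $l_j,u_j\in\mathbb{R}\cup\{\pm\infty\}$ with no fixed variables ($l_j<u_j$), $K$ is a Cartesian product of $m$ copies of $\mathbb{R}_+,\{0\},\mathbb{R}_-$. $\operatorname{lin}C$ is the lineality space; $N_C(z)=\{y:\langle y,z'-z\rangle\le0\ \forall z'\in C\}$; $\operatorname{aff}$ is the affine hull. "$M$ is invertible on the lineality space of $C$" means $Q^TMQ$ is invertible, where the columns of $Q$ are an orthonormal basis of $\operatorname{lin}C$ (vacuous if trivial). A point $z\in C$ is an implicit extreme point of $C$ if $z=\lambda z^1+(1-\lambda)z^2$ with $z^1,z^2\in C$, $\lambda\in(0,1)$ implies $z-z^1,z-z^2\in\operatorname{lin}C$. $X_{\alpha\beta}$ denotes the submatrix of $X$ with rows $\alpha$, columns $\beta$; $A^T_{\alpha\beta}=(A_{\alpha\beta})^T$; $I_\alpha$ is the identity of size $|\alpha|$. Index sets associated with $\bar z^0$: $\{1,\dots,n\}$ is partitioned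 into $B$ (basic variables), $N_l$ (nonbasic at finite lower bounds), $N_u$ (nonbasic at finite upper bounds), $N_{fr}$ (nonbasic free variables, i.e. $l_j=-\infty,u_j=\infty$); $\{1,\dots,m\}$ is partitioned into $\mathcal{A}$ (active constraints, $A_{\mathcal{A}\bullet}\bar z^0=b_{\mathcal{A}}$) and $\bar{\mathcal{A}}$ (the remaining constraints, with basic slacks); $|\mathcal{A}|=|B|$ and $A_{\mathcal{A}B}$ is invertible; $\bar z^0_{N_l}=l_{N_l}$, $\bar z^0_{N_u}=u_{N_u}$, $\bar z^0_{N_{fr}}=0$, $\bar z^0_B=A_{\mathcal{A}B}^{-1}(b_{\mathcal{A}}-A_{\mathcal{A}N}\bar z^0_N)$; $\bar z^0\in C$. They are those produced by pivoting, starting from a basic feasible solution, nonbasic free variables into the basis in exchange for non-free basic variables (structural or slack) as long as a ratio test over non-free basic variables is finite; consequently $\dim(\operatorname{lin}C)=|N_{fr}|$ and the vectors $v^j$, $j\in N_{fr}$, with $v^j_B=-A_{\mathcal{A}B}^{-1}A_{\mathcal{A},j}$, $v^j_j=1$ and all other components $0$, form a basis of $\operatorname{lin}C$. *)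

theory Defs
  imports "HOL-Analysis.Analysis"
begin

section \<open>Matrices indexed by finite sets\<close>

text \<open>A submatrix \<open>X\<^sub>\<alpha>\<^sub>\<beta>\<close> is the restriction of the entry function \<open>X\<close> to
  \<open>\<alpha> \<times> \<beta>\<close>; values outside the index sets are ignored. Inverses are two-sided, with rows
  and columns indexed by different sets.\<close>

definition is_inverse_on :: "'i set \<Rightarrow> 'j set \<Rightarrow> ('i \<Rightarrow> 'j \<Rightarrow> real) \<Rightarrow> ('j \<Rightarrow> 'i \<Rightarrow> real) \<Rightarrow> bool" where
  "is_inverse_on \<alpha> \<beta> X Y \<longleftrightarrow>
     (\<forall>i\<in>\<alpha>. \<forall>i'\<in>\<alpha>. (\<Sum>j\<in>\<beta>. X i j * Y j i') = (if i = i' then 1 else 0)) \<and>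
     (\<forall>j\<in>\<beta>. \<forall>j'\<in>\<beta>. (\<Sum>i\<in>\<alpha>. Y j i * X i j') = (if j = j' then 1 else 0))"

definition invertible_on :: "'i set \<Rightarrow> 'j set \<Rightarrow> ('i \<Rightarrow> 'j \<Rightarrow> real) \<Rightarrow> bool" where
  "invertible_on \<alpha> \<beta> X \<longleftrightarrow> (\<exists>Y. is_inverse_on \<alpha> \<beta> X Y)"

definition inverse_on :: "'i set \<Rightarrow> 'j set \<Rightarrow> ('i \<Rightarrow> 'j \<Rightarrow> real) \<Rightarrow> 'j \<Rightarrow> 'i \<Rightarrow> real" where
  "inverse_on \<alpha> \<beta> X = (SOME Y. is_inverse_on \<alpha> \<beta> X Y)"


section \<open>Convex geometry\<close>

definition lineality_space :: "'a::real_vector set \<Rightarrow> 'a set" where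
  "lineality_space C = {d. \<forall>z\<in>C. \<forall>t::real. z + t *\<^sub>R d \<in> C}"

definition normal_cone :: "'a::real_inner set \<Rightarrow> 'a \<Rightarrow> 'a set" where
  "normal_cone C z = {y. \<forall>z'\<in>C. y \<bullet> (z' - z) \<le> 0}"

definition implicit_extreme_point :: "'a::real_vector set \<Rightarrow> 'a \<Rightarrow> bool" where
  "implicit_extreme_point C z \<longleftrightarrow> z \<in> C \<and>
     (\<forall>z1\<in>C. \<forall>z2\<in>C. \<forall>t::real. 0 < t \<and> t < 1 \<and> z = t *\<^sub>R z1 + (1 - t) *\<^sub>R z2 \<longrightarrow>
        z - z1 \<in> lineality_space C \<and> z - z2 \<in> lineality_space C)"

definition orthonormal_basis :: "'a::euclidean_space set \<Rightarrow> 'a set \<Rightarrow> bool" where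
  "orthonormal_basis L Q \<longleftrightarrow>
     pairwise orthogonal Q \<and> (\<forall>x\<in>Q. norm x = 1) \<and> independent Q \<and> span Q = L"

text \<open>The columns of the matrix \<open>Q\<close> are the elements of an orthonormal basis, which also serve as
  their own column indices; the \<open>(x, y)\<close> entry of \<open>Q\<^sup>T M Q\<close> is then \<open>x \<bullet> (M *v y)\<close>. For the
  trivial subspace the index set is empty and the condition holds vacuously.\<close>

definition invertible_on_subspace :: "real^'n^'n \<Rightarrow> (real^'n) set \<Rightarrow> bool" where
  "invertible_on_subspace M L \<longleftrightarrow>
     (\<exists>Q. orthonormal_basis L Q \<and> invertible_on Q Q (\<lambda>x y. x \<bullet> (M *v y)))"


section \<open>Index sets of a basic feasible solution\<close>

text \<open>The displacement \<open>v\<^sup>j\<close> caused by a unit increase of the nonbasic variable \<open>j\<close>.\<close>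

definition nonbasic_direction :: "real^'n^'m \<Rightarrow> 'm set \<Rightarrow> 'n set \<Rightarrow> 'n \<Rightarrow> real^'n" where
  "nonbasic_direction A Act B j = (\<chi> k.
     if k \<in> B then - (\<Sum>i\<in>Act. inverse_on Act B (\<lambda>i j. A $ i $ j) k i * A $ i $ j)
     else if k = j then 1 else 0)"

text \<open>Largest step \<open>t\<close> for which \<open>x + t * d\<close> stays in \<open>[lo, hi]\<close>, for \<open>x\<close> in that interval.\<close>

definition step_ratio :: "ereal \<Rightarrow> ereal \<Rightarrow> real \<Rightarrow> real \<Rightarrow> ereal" where
  "step_ratio lo hi x d =
     (if d < 0 then (ereal x - lo) / ereal (- d)
      else if 0 < d then (hi - ereal x) / ereal d
      else \<infinity>)"

text \<open>Ratio test along \<open>d\<close> over the non-free basic variables. The slack of constraint \<open>i\<close> is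
  \<open>(A *v z - b) $ i\<close>, restricted to \<open>\<kappa> i\<close>, which is one of \<open>{0..}\<close>, \<open>{0}\<close>, \<open>{..0}\<close>; so slacks are
  never free, and their bounds are the infimum and the supremum of \<open>\<kappa> i\<close>.\<close>

definition ratio_test ::
  "real^'n^'m \<Rightarrow> real^'m \<Rightarrow> ('m \<Rightarrow> real set) \<Rightarrow> ereal^'n \<Rightarrow> ereal^'n \<Rightarrow> 'n set \<Rightarrow> 'm set
     \<Rightarrow> real^'n \<Rightarrow> real^'n \<Rightarrow> ereal" where
  "ratio_test A b \<kappa> l u B Inact z d = min
     (INF k\<in>{k \<in> B. \<not> (l $ k = -\<infinity> \<and> u $ k = \<infinity>)}. step_ratio (l $ k) (u $ k) (z $ k) (d $ k))
     (INF i\<in>Inact. step_ratio (INF y\<in>\<kappa> i. ereal y) (SUP y\<in>\<kappa> i. ereal y)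
                       ((A *v z - b) $ i) ((A *v d) $ i))"

text \<open>The sets \<open>B, Nl, Nu, Nfr, Act, Inact\<close> describe \<open>z0\<close> as a basic solution at which the pivoting
  of nonbasic free variables into the basis has stopped: no nonbasic free variable, whether
  increased or decreased, has a finite ratio test. Feasibility of \<open>z0\<close> is not included.\<close>

definition associated_index_sets ::
  "real^'n^'m \<Rightarrow> real^'m \<Rightarrow> ('m \<Rightarrow> real set) \<Rightarrow> ereal^'n \<Rightarrow> ereal^'n \<Rightarrow> real^'n
     \<Rightarrow> 'n set \<Rightarrow> 'n set \<Rightarrow> 'n set \<Rightarrow> 'n set \<Rightarrow> 'm set \<Rightarrow> 'm set \<Rightarrow> bool" where
  "associated_index_sets A b \<kappa> l u z0 B Nl Nu Nfr Act Inact \<longleftrightarrow>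
     B \<union> Nl \<union> Nu \<union> Nfr = UNIV \<and>
     B \<inter> Nl = {} \<and> B \<inter> Nu = {} \<and> B \<inter> Nfr = {} \<and> Nl \<inter> Nu = {} \<and> Nl \<inter> Nfr = {} \<and> Nu \<inter> Nfr = {} \<and>
     Act \<union> Inact = UNIV \<and> Act \<inter> Inact = {} \<and>
     card Act = card B \<and> invertible_on Act B (\<lambda>i j. A $ i $ j) \<and>
     (\<forall>i\<in>Act. (A *v z0) $ i = b $ i) \<and>
     (\<forall>j\<in>Nl. l $ j = ereal (z0 $ j)) \<and>
     (\<forall>j\<in>Nu. u $ j = ereal (z0 $ j)) \<and>
     (\<forall>j\<in>Nfr. l $ j = -\<infinity> \<and> u $ j = \<infinity> \<and> z0 $ j = 0) \<and>
     (\<forall>j\<in>B. z0 $ j = (\<Sum>i\<in>Act. inverse_on Act B (\<lambda>i j. A $ i $ j) j i *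
                          (b $ i - (\<Sum>k\<in>Nl \<union> Nu \<union> Nfr. A $ i $ k * z0 $ k)))) \<and>
     (\<forall>j\<in>Nfr. \<forall>\<sigma>\<in>{1, -1}.
        ratio_test A b \<kappa> l u B Inact z0 (\<sigma> *\<^sub>R nonbasic_direction A Act B j) = \<infinity>)"


section \<open>The linear system\<close>

text \<open>Rows and columns of the block matrix are both indexed by \<open>'n + 'm\<close>.
  Row \<open>Inl i\<close> is the \<open>i\<close>-th row of the first four row blocks (\<open>i\<close> in \<open>B\<close>, \<open>Nl\<close>, \<open>Nu\<close>, \<open>Nfr\<close>);
  row \<open>Inr i\<close> is the \<open>i\<close>-th row of the last two (\<open>i\<close> in \<open>Act\<close>, \<open>Inact\<close>).
  Column \<open>Inl j\<close> belongs to the unknown \<open>z\<^sub>j\<close> if \<open>j\<close> is in \<open>B \<union> Nfr\<close>, to \<open>w\<^sub>j\<close> if \<open>j\<close> is in \<open>Nl\<close>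
  and to \<open>v\<^sub>j\<close> if \<open>j\<close> is in \<open>Nu\<close>; column \<open>Inr k\<close> belongs to \<open>\<lambda>\<^sub>k\<close> if \<open>k\<close> is in \<open>Act\<close> and to \<open>s\<^sub>k\<close>
  if \<open>k\<close> is in \<open>Inact\<close>.\<close>

definition system_matrix ::
  "real^'n^'n \<Rightarrow> real^'n^'m \<Rightarrow> 'n set \<Rightarrow> 'n set \<Rightarrow> 'n set \<Rightarrow> 'n set \<Rightarrow> 'm set \<Rightarrow> 'm set
     \<Rightarrow> real^('n + 'm)^('n + 'm)" where
  "system_matrix M A B Nl Nu Nfr Act Inact = (\<chi> r c.
     (case r of
        Inl i \<Rightarrow>
          (case c of
             Inl j \<Rightarrow> (if j \<in> B \<union> Nfr then M $ i $ j
                       else if j \<in> Nl then (if i = j then -1 else 0)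
                       else if j \<in> Nu then (if i = j then 1 else 0)
                       else 0)
           | Inr k \<Rightarrow> (if k \<in> Act then - (A $ k $ i) else 0))
      | Inr i \<Rightarrow>
          (case c of
             Inl j \<Rightarrow> (if j \<in> B \<union> Nfr then A $ i $ j else 0)
           | Inr k \<Rightarrow> (if k \<in> Inact \<and> i = k then -1 else 0))))"

definition system_rhs ::
  "real^'n^'n \<Rightarrow> real^'n \<Rightarrow> real^'n^'m \<Rightarrow> real^'m \<Rightarrow> real^'n \<Rightarrow> 'n set \<Rightarrow> real^('n + 'm)" where
  "system_rhs M q A b z0 N = (\<chi> r.
     (case r of
        Inl i \<Rightarrow> - (q $ i) - (\<Sum>j\<in>N. M $ i $ j * z0 $ j)
      | Inr i \<Rightarrow> b $ i - (\<Sum>j\<in>N. A $ i $ j * z0 $ j)))"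

definition solution_point :: "real^'n \<Rightarrow> 'n set \<Rightarrow> 'n set \<Rightarrow> real^('n + 'm::finite) \<Rightarrow> real^'n" where
  "solution_point z0 B Nfr x = (\<chi> j. if j \<in> B \<union> Nfr then x $ Inl j else z0 $ j)"

end

theory Submission
  imports Defs
begin

text \<open>Infinite ratio tests in both directions force every non-free basic variable and every basic
  slack to be constant along \<open>v\<^sup>j\<close>. Hence \<open>lin C\<close> is the set of all \<open>d\<close> with \<open>d\<^sub>N\<^sub>l = 0\<close>,
  \<open>d\<^sub>N\<^sub>u = 0\<close> and \<open>A\<^sub>\<A> d = 0\<close>, and \<open>A d = 0\<close> on it. Every vector in the kernel of the system
  matrix therefore has \<open>z\<close>-part \<open>d \<in> lin C\<close>, slack part \<open>0\<close>, and \<open>M d\<close> orthogonal to \<open>lin C\<close>;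
  conversely, for such a \<open>d\<close> the multipliers are obtained from the rows in \<open>B\<close>, the remainder
  vanishes on \<open>N\<^sub>f\<^sub>r\<close> because it is orthogonal to the \<open>v\<^sup>j\<close>, and its other components are \<open>w\<close> and \<open>-v\<close>.
  For a solution of the system, the first four row blocks express \<open>M z + q\<close> through rows of active
  constraints and coordinate vectors of tight bounds, each of which is up to sign a normal vector
  at \<open>z\<close>.\<close>

section \<open>Linear algebra of matrices over finite index sets\<close>

lemma is_inverse_on_inverse_on:
  "invertible_on \<alpha> \<beta> X \<Longrightarrow> is_inverse_on \<alpha> \<beta> X (inverse_on \<alpha> \<beta> X)"
  unfolding invertible_on_def inverse_on_def by (erule someI_ex)

lemma invertible_on_transpose:
  assumes "invertible_on \<alpha> \<beta> X"
  shows "invertible_on \<beta> \<alpha> (\<lambda>j i. X i j)"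
proof -
  obtain Y where "is_inverse_on \<alpha> \<beta> X Y"
    using assms unfolding invertible_on_def by blast
  then have "is_inverse_on \<beta> \<alpha> (\<lambda>j i. X i j) (\<lambda>i j. Y j i)"
    unfolding is_inverse_on_def by (auto simp: mult.commute)
  then show ?thesis
    unfolding invertible_on_def by blast
qed

lemma is_inverse_on_mult_vec:
  assumes "is_inverse_on \<alpha> \<beta> X Y" "finite \<alpha>" "i \<in> \<alpha>"
  shows "(\<Sum>j\<in>\<beta>. X i j * (\<Sum>k\<in>\<alpha>. Y j k * c k)) = c i"
proof -
  have "(\<Sum>j\<in>\<beta>. X i j * (\<Sum>k\<in>\<alpha>. Y j k * c k)) = (\<Sum>k\<in>\<alpha>. (\<Sum>j\<in>\<beta>. X i j * Y j k) * c k)"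
    by (simp add: sum_distrib_left sum_distrib_right mult.assoc sum.swap[of _ \<alpha>])
  also have "\<dots> = (\<Sum>k\<in>\<alpha>. if i = k then c k else 0)"
    using assms(1,3) unfolding is_inverse_on_def by (intro sum.cong) auto
  also have "\<dots> = c i"
    using assms(2,3) by simp
  finally show ?thesis .
qed

lemma is_inverse_on_commute:
  "is_inverse_on \<alpha> \<beta> X Y \<Longrightarrow> is_inverse_on \<beta> \<alpha> Y X"
  unfolding is_inverse_on_def by blast

lemma invertible_on_kernel:
  assumes "invertible_on \<alpha> \<beta> X" "finite \<beta>" "\<And>i. i \<in> \<alpha> \<Longrightarrow> (\<Sum>j\<in>\<beta>. X i j * c j) = 0" "j \<in> \<beta>"
  shows "c j = 0"
proof -
  obtain Y where "is_inverse_on \<alpha> \<beta> X Y"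
    using assms(1) unfolding invertible_on_def by blast
  from is_inverse_on_mult_vec[OF is_inverse_on_commute[OF this] assms(2,4), of c]
  show ?thesis using assms(3) by simp
qed

lemma invertible_on_solvable:
  assumes "invertible_on \<alpha> \<beta> X" "finite \<alpha>"
  obtains y where "\<And>i. i \<in> \<alpha> \<Longrightarrow> (\<Sum>j\<in>\<beta>. X i j * y j) = c i"
proof -
  obtain Y where "is_inverse_on \<alpha> \<beta> X Y"
    using assms(1) unfolding invertible_on_def by blast
  from is_inverse_on_mult_vec[OF this assms(2), of _ c]
  show ?thesis by (rule that)
qed

section \<open>Orthonormal bases and invertibility on a subspace\<close>

lemma orthonormal_basis_expansion:
  fixes Q :: "'a::euclidean_space set"
  assumes "orthonormal_basis L Q" "x \<in> L"
  shows "(\<Sum>y\<in>Q. (y \<bullet> x) *\<^sub>R y) = x"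
proof -
  have fin: "finite Q" and orth: "pairwise orthogonal Q"
    using assms(1) independent_bound by (auto simp: orthonormal_basis_def)
  have one: "y \<bullet> y = 1" if "y \<in> Q" for y
    using assms(1) that by (simp add: orthonormal_basis_def dot_square_norm)
  \<comment> \<open>The residual lies in the span of \<open>Q\<close> and is orthogonal to every
    element of \<open>Q\<close>, hence orthogonal to itself.\<close>
  let ?r = "x - (\<Sum>y\<in>Q. (y \<bullet> x) *\<^sub>R y)"
  have "?r \<in> span Q"
    using assms by (auto simp: orthonormal_basis_def intro!: span_diff span_sum span_scale intro: span_base)
  moreover have "orthogonal ?r y" if "y \<in> Q" for y
  proof -
    have "(\<Sum>z\<in>Q. (z \<bullet> x) *\<^sub>R z) \<bullet> y = (\<Sum>z\<in>Q. if z = y then y \<bullet> x else 0)"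
      unfolding inner_sum_left using orth that one
      by (intro sum.cong) (auto simp: pairwise_def orthogonal_def)
    then show ?thesis
      using fin that by (simp add: orthogonal_def inner_diff_left inner_commute[of y x])
  qed
  ultimately have "orthogonal ?r ?r"
    by (rule orthogonal_to_span)
  then show ?thesis by (simp add: orthogonal_def)
qed

text \<open>In the coordinates given by \<open>Q\<close> the matrix represents the compression of
  \<open>M\<close> to \<open>L\<close>, an endomorphism of a finite-dimensional space, so a trivial
  kernel suffices for invertibility. The criterion mentions no basis, which lets it be compared
  directly with the kernel of the block matrix.\<close>

lemma invertible_on_subspace_iff:
  fixes M :: "real^'n^'n"
  assumes L: "subspace L"
  shows "invertible_on_subspace M L \<longleftrightarrow> (\<forall>d\<in>L. (\<forall>e\<in>L. e \<bullet> (M *v d) = 0) \<longrightarrow> d = 0)"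
proof (intro iffI ballI impI)
  fix d assume "invertible_on_subspace M L" and d: "d \<in> L" and ker: "\<forall>e\<in>L. e \<bullet> (M *v d) = 0"
  then obtain Q where Q: "orthonormal_basis L Q" and inv: "invertible_on Q Q (\<lambda>x y. x \<bullet> (M *v y))"
    unfolding invertible_on_subspace_def by blast
  have fin: "finite Q" and sub: "Q \<subseteq> L"
    using Q independent_bound span_superset by (auto simp: orthonormal_basis_def)
  note exp = orthonormal_basis_expansion[OF Q d]
  have "(\<Sum>y\<in>Q. x \<bullet> (M *v y) * (y \<bullet> d)) = 0" if "x \<in> Q" for x
  proof -
    have "(\<Sum>y\<in>Q. x \<bullet> (M *v y) * (y \<bullet> d)) = x \<bullet> (M *v (\<Sum>y\<in>Q. (y \<bullet> d) *\<^sub>R y))"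
      by (simp add: linear_sum[OF matrix_vector_mul_linear] matrix_vector_mult_scaleR
          inner_sum_right mult.commute)
    then show ?thesis
      using exp ker sub that by auto
  qed
  then have "y \<bullet> d = 0" if "y \<in> Q" for y
    using invertible_on_kernel[OF inv fin _ that, of "\<lambda>y. y \<bullet> d"] by blast
  then show "d = 0"
    using exp by simp
next
  assume ker: "\<forall>d\<in>L. (\<forall>e\<in>L. e \<bullet> (M *v d) = 0) \<longrightarrow> d = 0"
  obtain Q where "pairwise orthogonal Q" "\<And>x. x \<in> Q \<Longrightarrow> norm x = 1" "independent Q" "span Q = L"
    using orthonormal_basis_subspace[OF L] by metis
  then have Q: "orthonormal_basis L Q"
    by (simp add: orthonormal_basis_def)
  have fin: "finite Q" and sub: "Q \<subseteq> L"
    using Q independent_bound span_superset by (auto simp: orthonormal_basis_def)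
  have delta: "x \<bullet> y = (if x = y then 1 else 0)" if "x \<in> Q" "y \<in> Q" for x y
    using Q that by (auto simp: orthonormal_basis_def pairwise_def orthogonal_def dot_square_norm)
  \<comment> \<open>\<open>P\<close> is the orthogonal projection onto \<open>L\<close>;
    \<open>inner_P\<close> below expresses that it is self-adjoint and fixes
    \<open>L\<close>.\<close>
  define P where "P x = (\<Sum>y\<in>Q. (y \<bullet> x) *\<^sub>R y)" for x
  have linP: "linear P"
    unfolding P_def
    by (rule linearI) (simp_all add: inner_add_right scaleR_add_left sum.distrib scaleR_sum_right)
  have P_in: "P x \<in> L" for x
    unfolding P_def using L sub by (auto intro!: subspace_sum subspace_scale)
  have P_id: "P x = x" if "x \<in> L" for x
    unfolding P_def using orthonormal_basis_expansion[OF Q that] .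
  have inner_P: "e \<bullet> P x = e \<bullet> x" if "e \<in> L" for e x
  proof -
    have "e \<bullet> P x = P e \<bullet> x"
      by (simp add: P_def inner_sum_left inner_sum_right inner_commute mult.commute)
    then show ?thesis using P_id[OF that] by simp
  qed
  txt \<open>Extend the compression of \<open>M\<close> to \<open>L\<close> by the identity on the orthogonal complement, so that
    its inverse is available as a linear map of the whole space.\<close>
  define F where "F x = P (M *v P x) + (x - P x)" for x
  have linF: "linear F"
    unfolding F_def
    by (intro linear_compose_add linear_compose_sub linear_id[unfolded id_def] linP
        linear_compose[OF linear_compose[OF linP matrix_vector_mul_linear] linP, unfolded o_def])
  \<comment> \<open>If \<open>F x\<close> is in \<open>L\<close>, then so is \<open>x - P x\<close>;
    as \<open>P\<close> fixes \<open>L\<close> but kills \<open>x - P x\<close>, the difference is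
    zero.\<close>
  have fix_if: "P x = x" if "F x \<in> L" for x
  proof -
    have "x - P x = F x - P (M *v P x)" by (simp add: F_def)
    then have "P (x - P x) = x - P x"
      using that P_in L by (intro P_id) (simp add: subspace_diff)
    moreover have "P (x - P x) = 0"
      using linear_diff[OF linP] P_id[OF P_in] by simp
    ultimately show ?thesis by simp
  qed
  have "inj F"
  proof (subst linear_injective_0[OF linF], intro allI impI)
    fix x assume F0: "F x = 0"
    then have Px: "P x = x" using fix_if subspace_0[OF L] by simp
    with F0 have "P (M *v x) = 0" by (simp add: F_def)
    then have "\<forall>e\<in>L. e \<bullet> (M *v x) = 0" by (metis inner_P inner_zero_right)
    moreover have "x \<in> L" using P_in[of x] Px by simp
    ultimately show "x = 0" using ker by blast
  qed
  then obtain G where linG: "linear G" and GF: "G (F x) = x" and FG: "F (G x) = x" for x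
    using linear_injective_isomorphism[OF linF] by metis
  have PG: "P (G y) = G y" if "y \<in> L" for y
    using fix_if[of "G y"] FG that by simp
  \<comment> \<open>The inverse matrix is the compression of \<open>G\<close> to \<open>L\<close>.
    Recognizing the inner sums as \<open>P\<close> turns the two matrix products into
    \<open>F (G y)\<close> and \<open>G (F y)\<close>; \<open>PG\<close> ensures that
    \<open>G\<close> does not leave \<open>L\<close>.\<close>
  have "is_inverse_on Q Q (\<lambda>x y. x \<bullet> (M *v y)) (\<lambda>x y. x \<bullet> G y)"
    unfolding is_inverse_on_def
  proof (intro conjI ballI)
    fix x y assume xy: "x \<in> Q" "y \<in> Q"
    have "(\<Sum>z\<in>Q. x \<bullet> (M *v z) * (z \<bullet> G y)) = x \<bullet> (M *v P (G y))"
      by (simp add: P_def linear_sum[OF matrix_vector_mul_linear] matrix_vector_mult_scaleR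
          inner_sum_right mult.commute)
    also have "\<dots> = x \<bullet> F (G y)"
      using inner_P PG subsetD[OF sub] xy by (simp add: F_def)
    finally show "(\<Sum>z\<in>Q. x \<bullet> (M *v z) * (z \<bullet> G y)) = (if x = y then 1 else 0)"
      using FG delta xy by simp
    have "(\<Sum>z\<in>Q. x \<bullet> G z * (z \<bullet> (M *v y))) = x \<bullet> G (P (M *v y))"
      by (simp add: P_def linear_sum[OF linG] linear_scale[OF linG] inner_sum_right mult.commute)
    also have "P (M *v y) = F y"
      using xy sub P_id[of y] by (auto simp: F_def)
    finally show "(\<Sum>z\<in>Q. x \<bullet> G z * (z \<bullet> (M *v y))) = (if x = y then 1 else 0)"
      using GF delta xy by simp
  qed
  with Q show "invertible_on_subspace M L"
    unfolding invertible_on_subspace_def invertible_on_def by blast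
qed

text \<open>Exactly one of \<open>d\<close> and \<open>- d\<close> is negative, so one ratio
  measures the distance to \<open>lo\<close> and the other the distance to \<open>hi\<close>. With
  \<open>x\<close> real and a positive finite divisor, an infinite ratio means an infinite
  bound.\<close>

lemma step_ratio_infinite_both:
  assumes "step_ratio lo hi x d = \<infinity>" "step_ratio lo hi x (- d) = \<infinity>" "d \<noteq> 0"
  shows "lo = -\<infinity>" "hi = \<infinity>"
  using assms by (cases lo; cases hi; auto simp: step_ratio_def split: if_splits)+

section \<open>Translations along the lineality space\<close>

lemma lineality_spaceD:
  "d \<in> lineality_space C \<Longrightarrow> z \<in> C \<Longrightarrow> z + t *\<^sub>R d \<in> C"
  by (simp add: lineality_space_def)

text \<open>Subtracting \<open>d\<close> from both points of a decomposition of \<open>z + d\<close>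
  gives a decomposition of \<open>z\<close> inside \<open>C\<close> with the same
  differences.\<close>

lemma implicit_extreme_point_translate:
  assumes "implicit_extreme_point C z" "d \<in> lineality_space C"
  shows "implicit_extreme_point C (z + d)"
  unfolding implicit_extreme_point_def
proof (intro conjI ballI allI impI)
  show "z + d \<in> C"
    using lineality_spaceD[OF assms(2), of z 1] assms(1) by (simp add: implicit_extreme_point_def)
  fix z1 z2 and t :: real
  assume z12: "z1 \<in> C" "z2 \<in> C" and t: "0 < t \<and> t < 1 \<and> z + d = t *\<^sub>R z1 + (1 - t) *\<^sub>R z2"
  have "z1 - d \<in> C" "z2 - d \<in> C"
    using lineality_spaceD[OF assms(2), of _ "-1"] z12 by force+
  moreover from t have "z = t *\<^sub>R (z1 - d) + (1 - t) *\<^sub>R (z2 - d)"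
    by (simp add: algebra_simps)
  ultimately have "z - (z1 - d) \<in> lineality_space C" "z - (z2 - d) \<in> lineality_space C"
    using assms(1) t unfolding implicit_extreme_point_def by blast+
  then show "z + d - z1 \<in> lineality_space C" "z + d - z2 \<in> lineality_space C"
    by (simp_all add: algebra_simps)
qed

section \<open>Nonbasic directions and the description of the lineality space\<close>

lemma matrix_vector_mult_nonbasic_direction:
  fixes A :: "real^'n^'m"
  assumes "invertible_on Act B (\<lambda>i j. A $ i $ j)" "j \<notin> B" "i \<in> Act"
  shows "(A *v nonbasic_direction A Act B j) $ i = 0"
proof -
  let ?v = "nonbasic_direction A Act B j" and ?Y = "inverse_on Act B (\<lambda>i j. A $ i $ j)"
  have "(A *v ?v) $ i = (\<Sum>k\<in>B. A $ i $ k * ?v $ k) + (\<Sum>k\<in>-B. A $ i $ k * ?v $ k)"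
    by (subst sum.union_disjoint[symmetric]) (simp_all add: matrix_vector_mult_def)
  \<comment> \<open>On \<open>B\<close> the inverse cancels against the matrix and leaves minus
    column \<open>j\<close>; the unit entry at \<open>j\<close> contributes the same column with a
    plus sign.\<close>
  also have "(\<Sum>k\<in>B. A $ i $ k * ?v $ k) = - (\<Sum>k\<in>B. A $ i $ k * (\<Sum>i'\<in>Act. ?Y k i' * A $ i' $ j))"
    by (simp add: nonbasic_direction_def sum_negf)
  also have "\<dots> = - A $ i $ j"
    using is_inverse_on_mult_vec[OF is_inverse_on_inverse_on[OF assms(1)] _ assms(3), of "\<lambda>i. A $ i $ j"]
    by simp
  also have "(\<Sum>k\<in>-B. A $ i $ k * ?v $ k) = (\<Sum>k\<in>-B. if k = j then A $ i $ j else 0)"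
    by (intro sum.cong) (auto simp: nonbasic_direction_def)
  also have "\<dots> = A $ i $ j"
    using assms(2) by simp
  finally show ?thesis by simp
qed

text \<open>Both sides agree off \<open>B\<close>, where the directions are unit vectors. Their
  difference is supported on \<open>B\<close> and annihilated by the active rows, so it vanishes
  because the basis matrix is invertible.\<close>

lemma eq_sum_nonbasic_directions:
  fixes A :: "real^'n^'m"
  assumes inv: "invertible_on Act B (\<lambda>i j. A $ i $ j)" and disj: "B \<inter> Nfr = {}"
    and d: "\<And>j. j \<notin> B \<union> Nfr \<Longrightarrow> d $ j = 0" "\<And>i. i \<in> Act \<Longrightarrow> (A *v d) $ i = 0"
  shows "d = (\<Sum>j\<in>Nfr. d $ j *\<^sub>R nonbasic_direction A Act B j)" (is "d = ?s")
proof -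
  define r where "r = d - ?s"
  have r0: "r $ k = 0" if k: "k \<notin> B" for k
  proof -
    have "?s $ k = (\<Sum>j\<in>Nfr. if k = j then d $ k else 0)"
      unfolding sum_component using k by (intro sum.cong) (auto simp: nonbasic_direction_def)
    then show ?thesis
      using d(1)[of k] k by (auto simp: r_def)
  qed
  have "(\<Sum>k\<in>B. A $ i $ k * r $ k) = 0" if "i \<in> Act" for i
  proof -
    have "(\<Sum>k\<in>B. A $ i $ k * r $ k) = (A *v r) $ i"
      unfolding matrix_vector_mult_def using r0 by (auto intro!: sum.mono_neutral_left)
    also have "\<dots> = - (A *v ?s) $ i"
      using d(2)[OF that] by (simp add: r_def matrix_vector_mult_diff_distrib)
    also have "A *v ?s = (\<Sum>j\<in>Nfr. d $ j *\<^sub>R (A *v nonbasic_direction A Act B j))"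
      by (simp add: linear_sum[OF matrix_vector_mul_linear] matrix_vector_mult_scaleR)
    also have "\<dots> $ i = 0"
      unfolding sum_component
    proof (intro sum.neutral ballI)
      fix j assume "j \<in> Nfr"
      then have "(A *v nonbasic_direction A Act B j) $ i = 0"
        using disj that by (intro matrix_vector_mult_nonbasic_direction[OF inv]) auto
      then show "(d $ j *\<^sub>R (A *v nonbasic_direction A Act B j)) $ i = 0" by simp
    qed
    finally show ?thesis by simp
  qed
  then have "r $ k = 0" if "k \<in> B" for k
    using invertible_on_kernel[OF inv _ _ that, of "\<lambda>k. r $ k"] by simp
  with r0 have "r = 0" by (metis vec_eq_iff zero_index)
  then show ?thesis by (simp add: r_def)
qed

text \<open>The ratio tests for both signs being infinite, a nonzero rate of change would need two
  infinite bounds by \<open>step_ratio_infinite_both\<close>. This is excluded for a non-free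
  variable, and for a slack because \<open>\<kappa> i\<close> lies on one side of 0.\<close>

lemma nonbasic_direction_infinite_ratio:
  fixes A :: "real^'n^'m"
  assumes K_factors: "\<And>i. \<kappa> i \<in> {{0..}, {0}, {..0}}"
    and idx: "associated_index_sets A b \<kappa> l u z0 B Nl Nu Nfr Act Inact" and j: "j \<in> Nfr"
  shows "A *v nonbasic_direction A Act B j = 0"
    and "l $ k \<noteq> -\<infinity> \<or> u $ k \<noteq> \<infinity> \<Longrightarrow> nonbasic_direction A Act B j $ k = 0"
proof -
  let ?v = "nonbasic_direction A Act B j"
  have inv: "invertible_on Act B (\<lambda>i j. A $ i $ j)" and jB: "j \<notin> B"
    and part: "Act \<union> Inact = UNIV"
    and free: "l $ j = -\<infinity>" "u $ j = \<infinity>"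
    using idx j unfolding associated_index_sets_def by blast+
  have "ratio_test A b \<kappa> l u B Inact z0 (\<sigma> *\<^sub>R ?v) = \<infinity>" if "\<sigma> \<in> {1, -1}" for \<sigma>
    using idx j that unfolding associated_index_sets_def by blast
  from this[of 1] this[of "-1"]
  have rt: "ratio_test A b \<kappa> l u B Inact z0 ?v = \<infinity>" "ratio_test A b \<kappa> l u B Inact z0 (- ?v) = \<infinity>"
    by simp_all
  have struct: "step_ratio (l $ k) (u $ k) (z0 $ k) (v $ k) = \<infinity>"
    if "ratio_test A b \<kappa> l u B Inact z0 v = \<infinity>" "k \<in> B" "l $ k \<noteq> -\<infinity> \<or> u $ k \<noteq> \<infinity>" for v k
  proof -
    have "ratio_test A b \<kappa> l u B Inact z0 v \<le> step_ratio (l $ k) (u $ k) (z0 $ k) (v $ k)"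
      unfolding ratio_test_def using that(2,3) by (intro min.coboundedI1 INF_lower) blast
    then show ?thesis using that(1) by simp
  qed
  have slack: "step_ratio (INF y\<in>\<kappa> i. ereal y) (SUP y\<in>\<kappa> i. ereal y) ((A *v z0 - b) $ i) ((A *v v) $ i) = \<infinity>"
    (is "?s = _") if "ratio_test A b \<kappa> l u B Inact z0 v = \<infinity>" "i \<in> Inact" for v i
  proof -
    have "ratio_test A b \<kappa> l u B Inact z0 v \<le> ?s"
      unfolding ratio_test_def using that(2) by (intro min.coboundedI2 INF_lower)
    then show ?thesis using that(1) by simp
  qed
  show "?v $ k = 0" if k: "l $ k \<noteq> -\<infinity> \<or> u $ k \<noteq> \<infinity>"
  proof (cases "k \<in> B")
    case True
    have "step_ratio (l $ k) (u $ k) (z0 $ k) (?v $ k) = \<infinity>"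
      "step_ratio (l $ k) (u $ k) (z0 $ k) (- ?v $ k) = \<infinity>"
      using struct[OF rt(1) True k] struct[OF rt(2) True k] by simp_all
    from step_ratio_infinite_both[OF this] show ?thesis using k by blast
  next
    case False
    \<comment> \<open>Off \<open>B\<close> only the entry at \<open>j\<close> is nonzero, and
      \<open>k\<close> differs from \<open>j\<close> because \<open>j\<close> is free.\<close>
    then show ?thesis using k free by (auto simp: nonbasic_direction_def)
  qed
  have "(A *v ?v) $ i = 0" for i
  proof (cases "i \<in> Act")
    case True
    then show ?thesis using matrix_vector_mult_nonbasic_direction[OF inv jB] by blast
  next
    case False
    then have i: "i \<in> Inact" using part by blast
    have neg: "A *v (- ?v) = - (A *v ?v)"
      by (simp add: linear_neg[OF matrix_vector_mul_linear])
    show ?thesis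
    proof (rule ccontr)
      assume nz: "(A *v ?v) $ i \<noteq> 0"
      have inf: "(INF y\<in>\<kappa> i. ereal y) = -\<infinity>" "(SUP y\<in>\<kappa> i. ereal y) = \<infinity>"
        using step_ratio_infinite_both[OF slack[OF rt(1) i] _ nz] slack[OF rt(2) i] neg by simp_all
      have "0 \<le> (INF y\<in>\<kappa> i. ereal y) \<or> (SUP y\<in>\<kappa> i. ereal y) \<le> 0"
      proof -
        consider "\<kappa> i \<subseteq> {0..}" | "\<kappa> i \<subseteq> {..0}"
          using K_factors[of i] by fastforce
        then show ?thesis
        proof cases
          case 1
          then show ?thesis by (intro disjI1 INF_greatest) auto
        next
          case 2
          then show ?thesis by (intro disjI2 SUP_least) auto
        qed
      qed
      with inf show False by simp
    qed
  qed
  then show "A *v ?v = 0" by (simp add: vec_eq_iff)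
qed

text \<open>One inclusion follows by moving from \<open>z0\<close>, where the bounds in
  \<open>Nl\<close> and \<open>Nu\<close> and the constraints in \<open>Act\<close> are tight. For
  the other, such a \<open>d\<close> is a combination of nonbasic directions, so it changes no slack
  and only free variables.\<close>

lemma lineality_space_index_sets:
  fixes A :: "real^'n^'m"
  assumes K_factors: "\<And>i. \<kappa> i \<in> {{0..}, {0}, {..0}}"
    and K_eq: "K = {y. \<forall>i. y $ i \<in> \<kappa> i}"
    and C_eq: "C = {z. A *v z - b \<in> K \<and> (\<forall>j. l $ j \<le> ereal (z $ j) \<and> ereal (z $ j) \<le> u $ j)}"
    and z0: "z0 \<in> C"
    and idx: "associated_index_sets A b \<kappa> l u z0 B Nl Nu Nfr Act Inact"
  shows "lineality_space C = {d. (\<forall>j\<in>Nl \<union> Nu. d $ j = 0) \<and> (\<forall>i\<in>Act. (A *v d) $ i = 0)}"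
    and "d \<in> lineality_space C \<Longrightarrow> A *v d = 0"
proof -
  have active: "\<forall>i\<in>Act. (A *v z0) $ i = b $ i"
    and lower: "\<forall>j\<in>Nl. l $ j = ereal (z0 $ j)" and upper: "\<forall>j\<in>Nu. u $ j = ereal (z0 $ j)"
    and inv: "invertible_on Act B (\<lambda>i j. A $ i $ j)"
    and disj: "B \<inter> Nfr = {}" and part: "B \<union> Nl \<union> Nu \<union> Nfr = UNIV"
    by (insert idx[unfolded associated_index_sets_def], (elim conjE, assumption)+)
  have *: "A *v d = 0" "l $ k \<noteq> -\<infinity> \<or> u $ k \<noteq> \<infinity> \<Longrightarrow> d $ k = 0"
    if d: "\<And>j. j \<in> Nl \<union> Nu \<Longrightarrow> d $ j = 0" "\<And>i. i \<in> Act \<Longrightarrow> (A *v d) $ i = 0" for d k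
  proof -
    have exp: "d = (\<Sum>j\<in>Nfr. d $ j *\<^sub>R nonbasic_direction A Act B j)"
    proof (rule eq_sum_nonbasic_directions[OF inv disj])
      show "d $ j = 0" if "j \<notin> B \<union> Nfr" for j
        using that part by (intro d(1)) blast
    qed (use d(2) in blast)
    note v = nonbasic_direction_infinite_ratio[OF K_factors idx]
    have "A *v d = (\<Sum>j\<in>Nfr. d $ j *\<^sub>R (A *v nonbasic_direction A Act B j))"
      using arg_cong[OF exp, of "(*v) A"]
      by (simp add: linear_sum[OF matrix_vector_mul_linear] matrix_vector_mult_scaleR)
    then show "A *v d = 0" using v(1) by simp
    assume "l $ k \<noteq> -\<infinity> \<or> u $ k \<noteq> \<infinity>"
    then have "(\<Sum>j\<in>Nfr. d $ j *\<^sub>R nonbasic_direction A Act B j) $ k = 0"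
      unfolding sum_component using v(2) by (intro sum.neutral ballI) simp
    with arg_cong[OF exp, of "\<lambda>d. d $ k"] show "d $ k = 0" by (rule trans)
  qed
  show eq: "lineality_space C = {d. (\<forall>j\<in>Nl \<union> Nu. d $ j = 0) \<and> (\<forall>i\<in>Act. (A *v d) $ i = 0)}"
  proof (intro set_eqI iffI CollectI conjI ballI)
    fix d j assume d: "d \<in> lineality_space C" and j: "j \<in> Nl \<union> Nu"
    have "z0 + t *\<^sub>R d \<in> C" for t
      using lineality_spaceD[OF d z0] .
    then have "l $ j \<le> ereal (z0 $ j + t * d $ j)" "ereal (z0 $ j + t * d $ j) \<le> u $ j" for t
      unfolding C_eq by auto
    \<comment> \<open>With these step lengths the variable changes by minus or plus the square of
      \<open>d $ j\<close>, so a tight bound forces the square to vanish.\<close>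
    from this(1)[of "- d $ j"] this(2)[of "d $ j"] show "d $ j = 0"
      using j lower upper by (auto simp: not_square_less_zero mult_le_0_iff)
  next
    fix d i assume d: "d \<in> lineality_space C" and i: "i \<in> Act"
    have "z0 + t *\<^sub>R d \<in> C" for t
      using lineality_spaceD[OF d z0] .
    then have "(A *v (z0 + t *\<^sub>R d) - b) $ i \<in> \<kappa> i" for t
      unfolding C_eq K_eq by blast
    then have "t * (A *v d) $ i \<in> \<kappa> i" for t
      using i active by (simp add: matrix_vector_right_distrib matrix_vector_mult_scaleR)
    \<comment> \<open>These two values of \<open>t\<close> put the square of
      \<open>(A *v d) $ i\<close> and its negative into \<open>\<kappa> i\<close>, which contains at
      most one sign.\<close>
    from this[of "(A *v d) $ i"] this[of "- (A *v d) $ i"]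
    have sq: "(A *v d) $ i * (A *v d) $ i \<in> \<kappa> i" "- ((A *v d) $ i * (A *v d) $ i) \<in> \<kappa> i"
      by simp_all
    consider "\<kappa> i = {0..}" | "\<kappa> i = {0}" | "\<kappa> i = {..0}"
      using K_factors[of i] by blast
    then have "(A *v d) $ i * (A *v d) $ i = 0"
    proof cases
      case 1
      show ?thesis using sq(2) zero_le_square unfolding 1 by (intro antisym) simp_all
    next
      case 2
      show ?thesis using sq(1) unfolding 2 by simp
    next
      case 3
      show ?thesis using sq(1) zero_le_square unfolding 3 by (intro antisym) simp_all
    qed
    then show "(A *v d) $ i = 0" by simp
  next
    fix d assume "d \<in> {d. (\<forall>j\<in>Nl \<union> Nu. d $ j = 0) \<and> (\<forall>i\<in>Act. (A *v d) $ i = 0)}"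
    then have Ad: "A *v d = 0" and dk: "\<And>k. l $ k \<noteq> -\<infinity> \<or> u $ k \<noteq> \<infinity> \<Longrightarrow> d $ k = 0"
      using * by blast+
    show "d \<in> lineality_space C"
      unfolding lineality_space_def
    proof (intro CollectI ballI allI)
      fix z t assume z: "z \<in> C"
      have "l $ j \<le> ereal (z $ j + t * d $ j) \<and> ereal (z $ j + t * d $ j) \<le> u $ j" for j
      proof (cases "l $ j \<noteq> -\<infinity> \<or> u $ j \<noteq> \<infinity>")
        case True
        then show ?thesis using z dk unfolding C_eq by simp
      qed auto
      then show "z + t *\<^sub>R d \<in> C"
        using z Ad unfolding C_eq
        by (simp add: matrix_vector_right_distrib matrix_vector_mult_scaleR)
    qed
  qed
  show "A *v d = 0" if "d \<in> lineality_space C"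
    using that * unfolding eq by blast
qed

section \<open>The block system written row by row\<close>

lemma sum_UNIV_Plus:
  fixes f :: "'n::finite + 'm::finite \<Rightarrow> real"
  shows "(\<Sum>c\<in>UNIV. f c) = (\<Sum>j\<in>UNIV. f (Inl j)) + (\<Sum>k\<in>UNIV. f (Inr k))"
  by (subst UNIV_Plus_UNIV[symmetric], subst sum.Plus) (simp_all add: comp_def)

text \<open>With offset 0, \<open>solution_point\<close> pads the unknowns \<open>z\<close> by zeros
  on \<open>Nl\<close> and \<open>Nu\<close>, so the blocks of \<open>M\<close> and \<open>A\<close>
  become full matrix products. What remains are the terms of the multipliers, bounds and
  slacks.\<close>

lemma system_matrix_mult:
  fixes A :: "real^'n^'m" and x :: "real^('n + 'm)"
  assumes disj: "B \<inter> Nl = {}" "B \<inter> Nu = {}" "Nl \<inter> Nfr = {}" "Nu \<inter> Nfr = {}" "Nl \<inter> Nu = {}"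
  shows "(system_matrix M A B Nl Nu Nfr Act Inact *v x) $ Inl i =
      (M *v solution_point 0 B Nfr x) $ i - (\<Sum>k\<in>Act. A $ k $ i * x $ Inr k)
        - (if i \<in> Nl then x $ Inl i else 0) + (if i \<in> Nu then x $ Inl i else 0)" (is ?thesis1)
    and "(system_matrix M A B Nl Nu Nfr Act Inact *v x) $ Inr k =
      (A *v solution_point 0 B Nfr x) $ k - (if k \<in> Inact then x $ Inr k else 0)" (is ?thesis2)
proof -
  let ?S = "system_matrix M A B Nl Nu Nfr Act Inact" and ?d = "solution_point 0 B Nfr x"
  have l: "?S $ Inl i $ Inl j * x $ Inl j =
      M $ i $ j * ?d $ j - (if i = j then (if i \<in> Nl then x $ Inl i else 0) else 0)
       + (if i = j then (if i \<in> Nu then x $ Inl i else 0) else 0)" for j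
    using disj by (auto simp: system_matrix_def solution_point_def)
  have "?S $ Inl i $ Inr k * x $ Inr k = (if k \<in> Act then - (A $ k $ i * x $ Inr k) else 0)" for k
    by (simp add: system_matrix_def)
  then show ?thesis1
    by (simp add: matrix_vector_mult_def[of ?S] sum_UNIV_Plus l sum.distrib sum_subtractf
        sum.If_cases sum_negf) (simp add: matrix_vector_mult_def)
  have "?S $ Inr k $ Inl j * x $ Inl j = A $ k $ j * ?d $ j" for j
    by (simp add: system_matrix_def solution_point_def)
  moreover have "?S $ Inr k $ Inr k' * x $ Inr k' =
      (if k = k' then (if k \<in> Inact then - x $ Inr k else 0) else 0)" for k'
    by (simp add: system_matrix_def)
  ultimately show ?thesis2
    by (simp add: matrix_vector_mult_def[of ?S] sum_UNIV_Plus) (simp add: matrix_vector_mult_def)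
qed

text \<open>The normal cone contains 0, so its affine hull is its span. Hence neither the signs of
  the generators nor those of the coefficients matter.\<close>

lemma affine_hull_normal_coneI:
  fixes A :: "real^'n^'m"
  assumes rows: "\<And>i. i \<in> Act \<Longrightarrow> row i A \<in> normal_cone C z \<or> - row i A \<in> normal_cone C z"
    and axes: "\<And>j. j \<in> J \<Longrightarrow> axis j 1 \<in> normal_cone C z \<or> - axis j 1 \<in> normal_cone C z"
    and y: "\<And>j. y $ j = (\<Sum>i\<in>Act. A $ i $ j * c i) + (if j \<in> J then w j else 0)"
  shows "y \<in> affine hull (normal_cone C z)"
proof -
  let ?N = "normal_cone C z"
  have span_if: "x \<in> span ?N" if "x \<in> ?N \<or> - x \<in> ?N" for x
    using that span_base span_neg[of "- x" ?N] by auto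
  have "0 \<in> ?N" by (simp add: normal_cone_def)
  then have "affine hull ?N = span ?N"
    by (intro affine_hull_span_0 hull_inc)
  moreover have "y = (\<Sum>i\<in>Act. c i *\<^sub>R row i A) + (\<Sum>j\<in>J. w j *\<^sub>R axis j 1)"
  proof (subst vec_eq_iff, rule allI)
    fix j
    have "(\<Sum>k\<in>J. w k * axis k 1 $ j) = (\<Sum>k\<in>J. if j = k then w j else 0)"
      by (intro sum.cong) (auto simp: axis_def)
    then show "y $ j = ((\<Sum>i\<in>Act. c i *\<^sub>R row i A) + (\<Sum>j\<in>J. w j *\<^sub>R axis j 1)) $ j"
      by (simp add: y row_def mult.commute[of "c _"])
  qed
  moreover have "\<dots> \<in> span ?N"
    using rows axes span_if by (intro span_add span_sum span_scale) blast+
  ultimately show ?thesis by simp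
qed

theorem proposition4p2:
  fixes A :: "real^'n^'m" and b :: "real^'m" and l u :: "ereal^'n"
    and \<kappa> :: "'m \<Rightarrow> real set" and K :: "(real^'m) set" and C :: "(real^'n) set"
    and M :: "real^'n^'n" and q z0 :: "real^'n"
    and B Nl Nu Nfr N :: "'n set" and Act Inact :: "'m set"
  assumes nonzero_rows: "\<And>i. row i A \<noteq> 0"
    and not_fixed: "\<And>j. l $ j < u $ j"
    and K_factors: "\<And>i. \<kappa> i \<in> {{0..}, {0}, {..0}}"
    and K_eq: "K = {y. \<forall>i. y $ i \<in> \<kappa> i}"
    and C_eq: "C = {z. A *v z - b \<in> K \<and> (\<forall>j. l $ j \<le> ereal (z $ j) \<and> ereal (z $ j) \<le> u $ j)}"
    and C_nonempty: "C \<noteq> {}"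
    and z0: "implicit_extreme_point C z0"
    and index_sets: "associated_index_sets A b \<kappa> l u z0 B Nl Nu Nfr Act Inact"
    and N_eq: "N = Nl \<union> Nu \<union> Nfr"
  shows "(invertible (system_matrix M A B Nl Nu Nfr Act Inact) \<longleftrightarrow>
            invertible_on_subspace M (lineality_space C)) \<and>
         (\<forall>x. system_matrix M A B Nl Nu Nfr Act Inact *v x = system_rhs M q A b z0 N \<longrightarrow>
            (let z = solution_point z0 B Nfr x in
               z \<in> (+) z0 ` lineality_space C \<and>
               implicit_extreme_point C z \<and>
               M *v z + q \<in> affine hull (normal_cone C z)))"
proof (intro conjI allI impI)
  let ?S = "system_matrix M A B Nl Nu Nfr Act Inact" and ?L = "lineality_space C"
  have part: "B \<union> Nl \<union> Nu \<union> Nfr = UNIV" and disj: "B \<inter> Nl = {}" "B \<inter> Nu = {}" "Nl \<inter> Nfr = {}"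
    "Nu \<inter> Nfr = {}" "Nl \<inter> Nu = {}" and disj': "B \<inter> Nfr = {}"
    and partm: "Act \<union> Inact = UNIV" and disjm: "Act \<inter> Inact = {}"
    and inv: "invertible_on Act B (\<lambda>i j. A $ i $ j)"
    and active: "\<forall>i\<in>Act. (A *v z0) $ i = b $ i"
    and lower: "\<forall>j\<in>Nl. l $ j = ereal (z0 $ j)" and upper: "\<forall>j\<in>Nu. u $ j = ereal (z0 $ j)"
    and free: "\<forall>j\<in>Nfr. l $ j = -\<infinity> \<and> u $ j = \<infinity> \<and> z0 $ j = 0"
    by (insert index_sets[unfolded associated_index_sets_def], (elim conjE, assumption)+)
  have z0C: "z0 \<in> C" using z0 by (simp add: implicit_extreme_point_def)
  note L = lineality_space_index_sets[OF K_factors K_eq C_eq z0C index_sets]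
  note S = system_matrix_mult[OF disj, of M A Act Inact]
  have subL: "subspace ?L"
    unfolding L(1) by (auto simp: subspace_def matrix_vector_right_distrib matrix_vector_mult_scaleR)

  \<comment> \<open>Invertibility: comparison of the two kernels\<close>
  show "invertible ?S \<longleftrightarrow> invertible_on_subspace M ?L"
    unfolding invertible_on_subspace_iff[OF subL] invertible_left_inverse matrix_left_invertible_ker
  proof (intro iffI ballI allI impI)
    fix d assume ker: "\<forall>x. ?S *v x = 0 \<longrightarrow> x = 0" and d: "d \<in> ?L"
      and orth: "\<forall>e\<in>?L. e \<bullet> (M *v d) = 0"
    \<comment> \<open>The transposed basis matrix is invertible, so multipliers exist that cancel
      \<open>M *v d\<close> on the rows in \<open>B\<close>.\<close>
    obtain y where y: "\<And>j. j \<in> B \<Longrightarrow> (\<Sum>i\<in>Act. A $ i $ j * y i) = (M *v d) $ j"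
      using invertible_on_solvable[OF invertible_on_transpose[OF inv], of "\<lambda>j. (M *v d) $ j"] by auto
    define r where "r = M *v d - (\<chi> j. \<Sum>i\<in>Act. A $ i $ j * y i)"
    \<comment> \<open>Since \<open>A *v e = 0\<close> on the lineality space, combinations of rows
      are orthogonal to it and subtracting one preserves orthogonality.\<close>
    have orth_r: "e \<bullet> r = 0" if e: "e \<in> ?L" for e
    proof -
      have "e \<bullet> (\<chi> j. \<Sum>i\<in>Act. A $ i $ j * y i) = (\<Sum>i\<in>Act. (A *v e) $ i * y i)"
        by (simp add: inner_vec_def matrix_vector_mult_def sum_distrib_left sum_distrib_right
            sum.swap[of _ Act] mult_ac)
      also have "\<dots> = 0" using e L(2) by simp
      finally show ?thesis using orth e by (simp add: r_def inner_diff_right)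
    qed
    have rB: "r $ j = 0" if "j \<in> B" for j
      using y[OF that] by (simp add: r_def)
    have rfr: "r $ j = 0" if j: "j \<in> Nfr" for j
    proof -
      let ?v = "nonbasic_direction A Act B j"
      have "A *v ?v = 0"
        using nonbasic_direction_infinite_ratio(1)[OF K_factors index_sets j] .
      then have "?v \<in> ?L"
        unfolding L(1) using j disj by (auto simp: nonbasic_direction_def)
      then have "0 = (\<Sum>k\<in>UNIV. ?v $ k * r $ k)"
        using orth_r by (simp add: inner_vec_def)
      also have "\<dots> = (\<Sum>k\<in>UNIV. if k = j then r $ j else 0)"
        using rB j disj' by (intro sum.cong) (auto simp: nonbasic_direction_def)
      finally show ?thesis by simp
    qed
    \<comment> \<open>The opposite signs on \<open>Nl\<close> and \<open>Nu\<close> match the blocks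
      \<open>-I\<close> and \<open>I\<close>; the slacks are 0 because
      \<open>A *v d = 0\<close>.\<close>
    define x :: "real^('n + 'm)" where
      "x = (\<chi> c. case c of Inl j \<Rightarrow> if j \<in> Nl then r $ j else if j \<in> Nu then - r $ j else d $ j
                          | Inr k \<Rightarrow> if k \<in> Act then y k else 0)"
    have xd: "solution_point 0 B Nfr x = d"
      using d part disj unfolding L(1) by (auto simp: solution_point_def x_def vec_eq_iff)
    have "(?S *v x) $ c = 0" for c
    proof (cases c)
      case (Inl j)
      have "(\<Sum>k\<in>Act. A $ k $ j * x $ Inr k) = (M *v d) $ j - r $ j"
        by (simp add: x_def r_def)
      moreover have "j \<in> B \<or> j \<in> Nl \<or> j \<in> Nu \<or> j \<in> Nfr" using part by blast
      ultimately show ?thesis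
        using Inl rB rfr disj by (auto simp: S xd) (auto simp: x_def)
    next
      case (Inr k)
      then show ?thesis
        using L(2)[OF d] disjm by (simp add: S xd) (auto simp: x_def)
    qed
    then have "x = 0" using ker by (simp add: vec_eq_iff)
    with xd show "d = 0" by (auto simp: solution_point_def vec_eq_iff split: if_splits)
  next
    fix x assume ker: "\<forall>d\<in>?L. (\<forall>e\<in>?L. e \<bullet> (M *v d) = 0) \<longrightarrow> d = 0" and Sx: "?S *v x = 0"
    let ?d = "solution_point 0 B Nfr x :: real^'n"
    have eq1: "(M *v ?d) $ i = (\<Sum>k\<in>Act. A $ k $ i * x $ Inr k)
        + (if i \<in> Nl then x $ Inl i else 0) - (if i \<in> Nu then x $ Inl i else 0)" for i
      using arg_cong[OF Sx, of "\<lambda>v. v $ Inl i"] S(1)[of x i] by simp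
    have eq2: "(A *v ?d) $ k = (if k \<in> Inact then x $ Inr k else 0)" for k
      using arg_cong[OF Sx, of "\<lambda>v. v $ Inr k"] S(2)[of x k] by simp
    have dL: "?d \<in> ?L"
      unfolding L(1) using disj disjm eq2 by (auto simp: solution_point_def)
    \<comment> \<open>Pairing \<open>eq1\<close> with \<open>e\<close> removes the bound terms, as
      \<open>e\<close> vanishes on \<open>Nl\<close> and \<open>Nu\<close>, and the multiplier
      terms, as \<open>A *v e = 0\<close>.\<close>
    have "e \<bullet> (M *v ?d) = 0" if e: "e \<in> ?L" for e
    proof -
      have "e \<bullet> (M *v ?d) = (\<Sum>i\<in>UNIV. e $ i * (\<Sum>k\<in>Act. A $ k $ i * x $ Inr k))"
        unfolding inner_vec_def using e unfolding L(1)
        by (intro sum.cong) (auto simp: eq1)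
      also have "\<dots> = (\<Sum>k\<in>Act. (A *v e) $ k * x $ Inr k)"
        by (simp add: matrix_vector_mult_def sum_distrib_left sum_distrib_right
            sum.swap[of _ Act] mult_ac)
      also have "\<dots> = 0" using L(2)[OF e] by simp
      finally show ?thesis .
    qed
    with ker dL have d0: "?d = 0" by blast
    \<comment> \<open>With a zero \<open>z\<close>-part, the rows in \<open>B\<close> say that the
      transposed basis matrix annihilates the multipliers.\<close>
    have "x $ Inr k = 0" if "k \<in> Act" for k
    proof (rule invertible_on_kernel[OF invertible_on_transpose[OF inv] _ _ that, of "\<lambda>k. x $ Inr k"])
      fix j assume "j \<in> B"
      then show "(\<Sum>i\<in>Act. A $ i $ j * x $ Inr i) = 0"
        using eq1[of j] d0 disj(1,2) by (auto simp: disjoint_iff)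
    qed simp
    then have xr: "x $ Inr k = 0" for k
      using eq2[of k] d0 partm by (cases "k \<in> Act") auto
    have xl: "x $ Inl j = 0" for j
    proof -
      have dj: "?d $ j = 0" by (simp only: d0 zero_index)
      have "j \<in> B \<union> Nfr \<or> j \<in> Nl \<or> j \<in> Nu" using part by blast
      then show ?thesis
      proof (elim disjE)
        assume "j \<in> B \<union> Nfr"
        then show ?thesis using dj by (simp add: solution_point_def)
      next
        assume "j \<in> Nl"
        then have "j \<notin> Nu" using disj by blast
        with \<open>j \<in> Nl\<close> show ?thesis using eq1[of j] xr d0 by simp
      next
        assume "j \<in> Nu"
        then have "j \<notin> Nl" using disj by blast
        with \<open>j \<in> Nu\<close> show ?thesis using eq1[of j] xr d0 by simp
      qed
    qed
    have "x $ c = 0" for c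
      by (cases c) (simp_all add: xl xr)
    then show "x = 0" by (simp add: vec_eq_iff)
  qed

  \<comment> \<open>The point determined by a solution of the system\<close>
  fix x assume Sx: "?S *v x = system_rhs M q A b z0 N"
  define z where "z = solution_point z0 B Nfr x"
  \<comment> \<open>This moves the nonbasic terms of the right-hand side into \<open>z\<close>, for
    \<open>X\<close> equal to \<open>M\<close> or \<open>A\<close>. On \<open>Nfr\<close> the
    entries of \<open>z0\<close> are 0, so adding them leaves the unknowns there unchanged.\<close>
  have zd: "X *v z = X *v solution_point 0 B Nfr x + (\<chi> i. \<Sum>j\<in>N. X $ i $ j * z0 $ j)" for X :: "real^'n^'k"
  proof -
    have "z = solution_point 0 B Nfr x + (\<chi> j. if j \<in> N then z0 $ j else 0)"
      using part disj disj' free unfolding N_eq z_def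
      by (auto simp: solution_point_def vec_eq_iff)
    then show ?thesis
      by (simp add: matrix_vector_right_distrib)
         (simp add: matrix_vector_mult_def if_distrib[of "\<lambda>t. _ * t"] sum.If_cases cong: if_cong)
  qed
  have eq1: "(M *v z + q) $ i = (\<Sum>k\<in>Act. A $ k $ i * x $ Inr k)
      + (if i \<in> Nl then x $ Inl i else 0) - (if i \<in> Nu then x $ Inl i else 0)" for i
    using arg_cong[OF Sx, of "\<lambda>v. v $ Inl i"] S(1)[of x i] by (simp add: zd system_rhs_def)
  have eq2: "(A *v z) $ k = b $ k" if "k \<in> Act" for k
  proof -
    have "k \<notin> Inact" using that disjm by blast
    then show ?thesis
      using arg_cong[OF Sx, of "\<lambda>v. v $ Inr k"] S(2)[of x k] by (simp add: zd system_rhs_def)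
  qed
  have zN: "z $ j = z0 $ j" if "j \<in> Nl \<union> Nu" for j
    using that disj by (auto simp: z_def solution_point_def)
  have d: "z - z0 \<in> ?L"
    unfolding L(1) using eq2 zN active by (simp add: matrix_vector_mult_diff_distrib)
  \<comment> \<open>As the constraint is tight at \<open>z\<close>, the product with
    \<open>z' - z\<close> is the slack of \<open>z'\<close>, whose sign is fixed by
    \<open>\<kappa> i\<close>.\<close>
  have rows: "row i A \<in> normal_cone C z \<or> - row i A \<in> normal_cone C z" if i: "i \<in> Act" for i
  proof -
    have "row i A \<bullet> (z' - z) \<in> \<kappa> i" if "z' \<in> C" for z'
    proof -
      have "row i A \<bullet> (z' - z) = (A *v z' - b) $ i"
        using eq2[OF i] unfolding matrix_vector_mul_component vector_minus_component
        by (simp add: inner_diff_right row_def matrix_vector_mul_component)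
      then show ?thesis using that by (simp add: C_eq K_eq)
    qed
    then show ?thesis
      using K_factors[of i] by (fastforce simp: normal_cone_def)
  qed
  have axes: "axis j 1 \<in> normal_cone C z \<or> - axis j 1 \<in> normal_cone C z" if j: "j \<in> Nl \<union> Nu" for j
  proof -
    have "(\<forall>z'\<in>C. z $ j \<le> z' $ j) \<or> (\<forall>z'\<in>C. z' $ j \<le> z $ j)"
      using j lower upper zN[OF j] unfolding C_eq by (auto; metis ereal_less_eq(3))
    then show ?thesis
      by (auto simp: normal_cone_def inner_axis')
  qed
  \<comment> \<open>By \<open>eq1\<close> the unknowns on \<open>Nu\<close> enter with a minus sign,
    whence the sign in \<open>w\<close>.\<close>
  have "M *v z + q \<in> affine hull (normal_cone C z)"
    using rows axes
    by (rule affine_hull_normal_coneI[where Act = Act and J = "Nl \<union> Nu" and c = "\<lambda>k. x $ Inr k"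
          and w = "\<lambda>j. if j \<in> Nl then x $ Inl j else - x $ Inl j"])
       (use disj in \<open>auto simp: eq1 simp del: vector_add_component\<close>)
  moreover have "z \<in> (+) z0 ` ?L"
    using d by (intro image_eqI[of _ _ "z - z0"]) simp_all
  moreover have "implicit_extreme_point C z"
    using implicit_extreme_point_translate[OF z0 d] by simp
  ultimately show "let z = solution_point z0 B Nfr x in z \<in> (+) z0 ` ?L \<and>
      implicit_extreme_point C z \<and> M *v z + q \<in> affine hull (normal_cone C z)"
    by (simp add: z_def)
qed

end
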